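(* Let $k\ge 1$ be an integer, let $u:\mathbb{R}\to\mathbb{R}$ be $k+1$ times differentiable, let $t_0\in\mathbb{R}$, and for $h>0$ put $u_{i^2}=u(t_0+i^2h)$ for $i=0,1,\dots,k$. Let $L(t)$ be the Lagrange interpolation polynomial of degree at most $k$ with $L(t_0+i^2h)=u_{i^2}$ for $i=0,1,\dots,k$. Define $$\beta_0^k=-\sum_{j=1}^{k}\frac{1}{j^2},\qquad \beta_i^k=\frac{(-1)^{k-1}(k!)^2}{i^2\prod_{0\le j\le k,\ j\ne i}(i^2-j^2)}\quad(i=1,\dots,k).$$ Then $$\frac{dL}{dt}(t_0)=\frac{1}{h}\sum_{i=0}^{k}\beta_i^k u_{i^2}$$ and $$\frac{du}{dt}(t_0)=\frac{1}{h}\sum_{i=0}^{k}\beta_i^k u_{i^2}+O(h^k)\qquad (h\to 0^+).$$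
   Context: The sample points $t_0,\ t_0+h,\ t_0+2^2h,\ \dots,\ t_0+k^2h$ are non-equidistant. The $O(h^k)$ is for fixed $u$, $t_0$ and $k$ as $h\to0^+$. *)

theory Defs
  imports
    "HOL-Analysis.Analysis"
    "HOL-Computational_Algebra.Polynomial"
    "HOL-Library.Landau_Symbols"
begin

text \<open>For functions on \<open>\<real>\<close>, the derivatives of order \<open>1, \<dots>, n\<close> exist everywhere; no continuity
  of the \<open>n\<close>-th derivative is required. The junk value of \<^const>\<open>deriv\<close> at
  non-differentiable points does not matter, since all lower orders are constrained too.\<close>

definition times_differentiable :: "nat \<Rightarrow> (real \<Rightarrow> real) \<Rightarrow> bool" where
  "times_differentiable n f \<longleftrightarrow> (\<forall>m<n. \<forall>t. (deriv ^^ m) f differentiable (at t))"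

definition lagrange_poly :: "nat \<Rightarrow> (nat \<Rightarrow> real) \<Rightarrow> (nat \<Rightarrow> real) \<Rightarrow> real poly" where
  "lagrange_poly k x y = (THE L. degree L \<le> k \<and> (\<forall>i\<le>k. poly L (x i) = y i))"

lemma ex1_lagrange_poly:
  assumes inj: "inj_on x {..k}"
  shows "\<exists>!L :: real poly. degree L \<le> k \<and> (\<forall>i\<le>k. poly L (x i) = y i)"
proof (rule ex_ex1I)
  define B where "B i = (\<Prod>j\<in>{..k}-{i}. [:- x j, 1:])" for i
  define L where "L = (\<Sum>i\<le>k. smult (y i / poly (B i) (x i)) (B i))"
  have degB: "degree (B i) \<le> k" if "i \<le> k" for i
  proof -
    have "degree (B i) \<le> (\<Sum>j\<in>{..k}-{i}. degree [:- x j, 1:])"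
      unfolding B_def by (rule order_trans[OF degree_prod_sum_le]) auto
    also have "\<dots> = k" using that by simp
    finally show ?thesis .
  qed
  have B0: "poly (B i) (x j) = 0" if "j \<le> k" "j \<noteq> i" for i j
    using that by (auto simp: B_def poly_prod)
  have B1: "poly (B i) (x i) \<noteq> 0" if "i \<le> k" for i
    using that inj by (auto simp: B_def poly_prod inj_on_def)
  have "degree L \<le> k"
    unfolding L_def by (intro degree_sum_le order_trans[OF degree_smult_le]) (auto simp: degB)
  moreover have "poly L (x i) = y i" if "i \<le> k" for i
  proof -
    have "poly L (x i) = (\<Sum>j\<le>k. if j = i then y i else 0)"
      unfolding L_def poly_sum by (rule sum.cong) (use that B0 B1 in auto)
    then show ?thesis using that by simp
  qed
  ultimately show "\<exists>L. degree L \<le> k \<and> (\<forall>i\<le>k. poly L (x i) = y i)" by blast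
next
  fix L M :: "real poly"
  assume L: "degree L \<le> k \<and> (\<forall>i\<le>k. poly L (x i) = y i)"
    and M: "degree M \<le> k \<and> (\<forall>i\<le>k. poly M (x i) = y i)"
  have "card (x ` {..k}) = Suc k" using inj by (simp add: card_image)
  then show "L = M"
    by (intro poly_eqI_degree[of "x ` {..k}"]) (use L M in auto)
qed

lemma lagrange_poly:
  assumes "inj_on x {..k}"
  shows "degree (lagrange_poly k x y) \<le> k"
    and "i \<le> k \<Longrightarrow> poly (lagrange_poly k x y) (x i) = y i"
  using theI'[OF ex1_lagrange_poly[OF assms, of y]] unfolding lagrange_poly_def by blast+

definition beta :: "nat \<Rightarrow> nat \<Rightarrow> real" where
  "beta k i =
    (if i = 0 then - (\<Sum>j=1..k. 1 / (real j)^2)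
     else ((-1)^(k-1) * (fact k)^2) /
          ((real i)^2 * (\<Prod>j\<in>{0..k}-{i}. (real i)^2 - (real j)^2)))"

end

theory Submission
  imports Defs
begin

text \<open>
  The numbers \<open>\<beta>\<^sub>i\<close> are the derivatives at \<open>0\<close> of the Lagrange basis polynomials for the nodes
  \<open>0, 1, 4, \<dots>, k\<^sup>2\<close> (\<open>poly_pderiv_square_basis_0\<close>). Expanding in this basis shows that the
  difference quotient with weights \<open>\<beta>\<^sub>i\<close> differentiates every polynomial of degree at most \<open>k\<close>
  exactly, after the affine change of variables that sends \<open>j\<^sup>2\<close> to \<open>t\<^sub>0 + j\<^sup>2 h\<close>
  (\<open>square_nodes_formula_exact\<close>). The interpolation polynomial \<open>L\<close> is such a polynomial, which gives
  the formula for \<open>L'(t\<^sub>0)\<close>.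

  The Taylor polynomial \<open>P\<close> of \<open>u\<close> at \<open>t\<^sub>0\<close> of degree \<open>k\<close> is another, and \<open>P'(t\<^sub>0) = u'(t\<^sub>0)\<close>
  as \<open>k \<ge> 1\<close>. So the error of the formula for \<open>u\<close> is the weighted sum of the Taylor
  remainders at the nodes divided by \<open>-h\<close>, and each remainder is \<open>O(h\<^sup>k\<^sup>+\<^sup>1)\<close>
  (\<open>right_taylor_approximation\<close>).
\<close>

definition square_basis :: "nat \<Rightarrow> nat \<Rightarrow> real poly" where
  "square_basis k i = smult (1 / (\<Prod>j\<in>{0..k}-{i}. (real i)^2 - (real j)^2))
                            (\<Prod>j\<in>{0..k}-{i}. [:- ((real j)^2), 1:])"

lemma degree_square_basis:
  assumes "i \<le> k"
  shows "degree (square_basis k i) \<le> k"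
proof -
  have "degree (\<Prod>j\<in>{0..k}-{i}. [:- ((real j)^2), 1:]) \<le> (\<Sum>j\<in>{0..k}-{i}. degree [:- ((real j)^2), 1:])"
    by (rule order_trans[OF degree_prod_sum_le]) auto
  also have "\<dots> = k" using assms by simp
  finally show ?thesis
    unfolding square_basis_def by (rule order_trans[OF degree_smult_le])
qed

lemma poly_square_basis:
  assumes "i \<le> k" "m \<le> k"
  shows "poly (square_basis k i) ((real m)^2) = (if m = i then 1 else 0)"
proof -
  have "(\<Prod>j\<in>{0..k}-{i}. (real i)^2 - (real j)^2) \<noteq> 0"
    by auto
  then show ?thesis
    using assms by (auto simp: square_basis_def poly_prod)
qed

lemma square_basis_expansion:
  assumes "degree q \<le> k"
  shows "q = (\<Sum>i=0..k. smult (poly q ((real i)^2)) (square_basis k i))"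
proof (rule poly_eqI_degree[of "(\<lambda>i. (real i)^2) ` {0..k}"])
  show "poly q x = poly (\<Sum>i=0..k. smult (poly q ((real i)^2)) (square_basis k i)) x"
    if "x \<in> (\<lambda>i. (real i)^2) ` {0..k}" for x
  proof -
    from that obtain m where m: "m \<le> k" "x = (real m)^2" by auto
    have "poly (\<Sum>i=0..k. smult (poly q ((real i)^2)) (square_basis k i)) x
        = (\<Sum>i=0..k. if i = m then poly q ((real m)^2) else 0)"
      unfolding poly_sum by (rule sum.cong) (use m in \<open>auto simp: poly_square_basis\<close>)
    then show ?thesis using m by simp
  qed
  have card: "card ((\<lambda>i. (real i)^2) ` {0..k}) = Suc k"
    by (subst card_image) (auto simp: inj_on_def)
  show "card ((\<lambda>i. (real i)^2) ` {0..k}) > degree q"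
    using assms card by simp
  have "degree (\<Sum>i=0..k. smult (poly q ((real i)^2)) (square_basis k i)) \<le> k"
    by (intro degree_sum_le order_trans[OF degree_smult_le]) (auto simp: degree_square_basis)
  then show "card ((\<lambda>i. (real i)^2) ` {0..k}) >
      degree (\<Sum>i=0..k. smult (poly q ((real i)^2)) (square_basis k i))"
    using card by simp
qed

lemma prod_neg_squares: "(\<Prod>j=1..k. - ((real j)^2)) = (-1)^k * (fact k)^2"
proof -
  have "(\<Prod>j=1..k. - ((real j)^2)) = (\<Prod>j=1..k. (-1) * (real j)^2)" by simp
  also have "\<dots> = (-1)^k * (\<Prod>j=1..k. real j)^2"
    by (simp only: prod.distrib prod_power_distrib) simp
  finally show ?thesis by (simp add: fact_prod)
qed

text \<open>The product rule leaves a single term when the node \<open>0\<close> is among the roots, and the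
  logarithmic derivative of the product when it is not. This is the case distinction in
  the definition of \<open>\<beta>\<close>.\<close>

lemma poly_pderiv_square_basis_0:
  assumes "i \<le> k"
  shows "poly (pderiv (square_basis k i)) 0 = beta k i"
proof (cases "i = 0")
  case True
  have S: "{0..k} - {0} = {1..k}" by auto
  define c where "c = (\<Prod>j=1..k. - ((real j)^2))"
  have c0: "c \<noteq> 0" by (auto simp: c_def)
  have del: "(\<Prod>j\<in>{1..k}-{a}. - ((real j)^2)) = c * (- (1 / (real a)^2))" if "a \<in> {1..k}" for a
    using prod.remove[of "{1..k}" a "\<lambda>j. - ((real j)^2)"] that
    by (simp add: c_def field_simps)
  have "poly (pderiv (square_basis k i)) 0
      = (1 / c) * (\<Sum>a\<in>{1..k}. \<Prod>j\<in>{1..k}-{a}. - ((real j)^2))"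
    unfolding square_basis_def True S
    by (simp add: pderiv_smult pderiv_prod poly_sum poly_prod c_def pderiv_pCons)
  also have "\<dots> = (1 / c) * (\<Sum>a\<in>{1..k}. c * (- (1 / (real a)^2)))"
    by (simp only: del cong: sum.cong)
  also have "\<dots> = - (\<Sum>a=1..k. 1 / (real a)^2)"
    using c0 by (subst sum_distrib_left[symmetric]) (simp add: sum_negf)
  finally show ?thesis by (simp add: beta_def True)
next
  case False
  define C where "C = (\<Prod>j\<in>{1..k}-{i}. [:- ((real j)^2), 1:])"
  define d where "d = (\<Prod>j\<in>{0..k}-{i}. (real i)^2 - (real j)^2)"
  have S: "{0..k} - {i} = insert 0 ({1..k} - {i})" using False by auto
  have "(\<Prod>j\<in>{0..k}-{i}. [:- ((real j)^2), 1:]) = [:0, 1:] * C"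
    unfolding S C_def by (subst prod.insert) auto
  then have "poly (pderiv (square_basis k i)) 0 = (1 / d) * poly C 0"
    unfolding square_basis_def d_def[symmetric]
    by (simp add: pderiv_smult pderiv_pCons)
  moreover have "- ((real i)^2) * poly C 0 = (-1)^k * (fact k)^2"
  proof -
    have "- ((real i)^2) * poly C 0 = (\<Prod>j=1..k. - ((real j)^2))"
      using prod.remove[of "{1..k}" i "\<lambda>j. - ((real j)^2)"] False assms
      by (simp add: C_def poly_prod)
    then show ?thesis by (simp only: prod_neg_squares)
  qed
  moreover have "(-1::real)^k = - ((-1)^(k-1))"
    using False assms by (cases k) auto
  ultimately have "poly C 0 = (-1)^(k-1) * (fact k)^2 / (real i)^2"
    and "poly (pderiv (square_basis k i)) 0 = (1 / d) * poly C 0"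
    using False by (simp_all add: field_simps)
  then show ?thesis
    using False by (simp add: beta_def d_def[symmetric])
qed

lemma square_nodes_formula_exact:
  fixes p :: "real poly"
  assumes "degree p \<le> k" and "h \<noteq> 0"
  shows "poly (pderiv p) t0 = 1 / h * (\<Sum>i=0..k. beta k i * poly p (t0 + (real i)^2 * h))"
proof -
  define q where "q = pcompose p [:t0, h:]"
  have "degree q \<le> k"
    using assms by (simp add: q_def degree_pcompose)
  then have "pderiv q = pderiv (\<Sum>i=0..k. smult (poly q ((real i)^2)) (square_basis k i))"
    by (subst square_basis_expansion) auto
  then have "poly (pderiv q) 0 = (\<Sum>i=0..k. poly q ((real i)^2) * poly (pderiv (square_basis k i)) 0)"
    by (simp add: higher_pderiv_sum[where n = 1, simplified] pderiv_smult poly_sum)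
  also have "\<dots> = (\<Sum>i=0..k. beta k i * poly p (t0 + (real i)^2 * h))"
    by (rule sum.cong) (auto simp: q_def poly_pcompose poly_pderiv_square_basis_0)
  finally have "h * poly (pderiv p) t0 = (\<Sum>i=0..k. beta k i * poly p (t0 + (real i)^2 * h))"
    by (simp add: q_def pderiv_pcompose poly_pcompose pderiv_pCons mult.commute)
  then show ?thesis using assms by (simp add: field_simps)
qed

lemma has_derivative_times_differentiable:
  assumes "times_differentiable n f" "m < n"
  shows "((deriv ^^ m) f has_real_derivative (deriv ^^ Suc m) f t) (at t)"
  using assms by (simp add: times_differentiable_def DERIV_deriv_iff_real_differentiable)

lemma differentiable_imp_local_lipschitz_at:
  fixes v :: "real \<Rightarrow> real"
  assumes "(v has_real_derivative D) (at a)"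
  obtains d where "d > 0" "\<And>t. \<bar>t - a\<bar> < d \<Longrightarrow> \<bar>v t - v a\<bar> \<le> (\<bar>D\<bar> + 1) * \<bar>t - a\<bar>"
proof -
  have "(v has_derivative (\<lambda>h. D * h)) (at a)"
    using assms by (simp add: has_field_derivative_def)
  then obtain d where "d > 0"
    and d: "\<And>t. norm (t - a) < d \<Longrightarrow> norm (v t - v a - D * (t - a)) \<le> 1 * norm (t - a)"
    unfolding has_derivative_at_alt using zero_less_one by blast
  have "\<bar>v t - v a\<bar> \<le> (\<bar>D\<bar> + 1) * \<bar>t - a\<bar>" if "\<bar>t - a\<bar> < d" for t
  proof -
    have "\<bar>v t - v a\<bar> \<le> \<bar>D * (t - a)\<bar> + \<bar>t - a\<bar>"
      using d[of t] that by simp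
    then show ?thesis by (simp add: abs_mult distrib_right)
  qed
  with \<open>d > 0\<close> show ?thesis by (rule that)
qed

text \<open>The derivative of order \<open>k + 1\<close> need not be bounded near \<open>a\<close>, so the Lagrange remainder of
  that order gives no bound. Instead the expansion stops at order \<open>k\<close>, and the intermediate
  value \<open>u\<^bsup>(k)\<^esup>(\<xi>)\<close> is replaced by \<open>u\<^bsup>(k)\<^esup>(a)\<close> at a cost of \<open>O(\<xi> - a)\<close>, by
  differentiability of \<open>u\<^bsup>(k)\<^esup>\<close> at the single point \<open>a\<close>.\<close>

lemma right_taylor_approximation:
  assumes "k \<ge> 1" and u: "times_differentiable (k + 1) u"
  obtains P C d where "degree P \<le> k" "poly (pderiv P) a = deriv u a" "d > 0"
    "\<And>s. 0 \<le> s \<Longrightarrow> s < d \<Longrightarrow> \<bar>u (a + s) - poly P (a + s)\<bar> \<le> C * s^(k+1)"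
proof -
  define v where "v = (\<lambda>m. (deriv ^^ m) u)"
  have der: "(v m has_real_derivative v (Suc m) t) (at t)" if "m \<le> k" for m t
    unfolding v_def using has_derivative_times_differentiable[OF u] that by auto
  define Q where "Q = (\<Sum>m\<le>k. monom (v m a / fact m) m)"
  define P where "P = pcompose Q [:- a, 1:]"
  have coeffQ: "coeff Q m = (if m \<le> k then v m a / fact m else 0)" for m
    by (simp add: Q_def coeff_sum)
  have polyP: "poly P (a + s) = (\<Sum>m\<le>k. v m a / fact m * s^m)" for s
    by (simp add: P_def Q_def poly_pcompose poly_sum poly_monom)
  have degP: "degree P \<le> k"
    by (simp add: P_def degree_pcompose degree_le coeffQ)
  have dP: "poly (pderiv P) a = deriv u a"
    using \<open>k \<ge> 1\<close>
    by (simp add: P_def pderiv_pcompose poly_pcompose pderiv_pCons poly_0_coeff_0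
        coeff_pderiv coeffQ v_def)
  obtain d where "d > 0"
    and d: "\<And>t. \<bar>t - a\<bar> < d \<Longrightarrow> \<bar>v k t - v k a\<bar> \<le> (\<bar>v (Suc k) a\<bar> + 1) * \<bar>t - a\<bar>"
    using differentiable_imp_local_lipschitz_at[OF der[OF order_refl]] by metis
  define K where "K = \<bar>v (Suc k) a\<bar> + 1"
  have K: "K \<ge> 0" by (simp add: K_def)
  have "\<bar>u (a + s) - poly P (a + s)\<bar> \<le> K / fact k * s^(k+1)" if s: "0 \<le> s" "s < d" for s
  proof (cases "s = 0")
    case True
    have "poly P (a + 0) = u a"
      unfolding polyP by (simp add: power_0_left v_def if_distrib cong: if_cong)
    with True show ?thesis by simp
  next
    case False
    with s have "s > 0" by simp
    then obtain t where t: "a < t" "t < a + s"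
      and ut: "u (a + s) = (\<Sum>m<k. v m a / fact m * s^m) + v k t / fact k * s^k"
      using Taylor_up[of k v u a "a + s" a] \<open>k \<ge> 1\<close> der by (auto simp: v_def)
    have "u (a + s) - poly P (a + s) = (v k t - v k a) / fact k * s^k"
      unfolding polyP ut by (simp add: lessThan_Suc_atMost[symmetric] algebra_simps diff_divide_distrib)
    then have "\<bar>u (a + s) - poly P (a + s)\<bar> = \<bar>v k t - v k a\<bar> * (s^k / fact k)"
      using s by (simp add: abs_mult)
    also have "\<dots> \<le> (K * s) * (s^k / fact k)"
    proof (rule mult_right_mono)
      have "\<bar>v k t - v k a\<bar> \<le> K * \<bar>t - a\<bar>"
        unfolding K_def by (rule d) (use t s in auto)
      also have "\<dots> \<le> K * s"
        by (rule mult_left_mono) (use t K in auto)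
      finally show "\<bar>v k t - v k a\<bar> \<le> K * s" .
    qed (use s in simp)
    finally show ?thesis by (simp add: mult.assoc)
  qed
  with degP dP \<open>d > 0\<close> show ?thesis by (rule that)
qed

theorem mainTheorem2:
  fixes k :: nat and u :: "real \<Rightarrow> real" and t0 :: real
  assumes "k \<ge> 1"
    and "times_differentiable (k + 1) u"
  shows "(\<forall>h>0. deriv (poly (lagrange_poly k (\<lambda>i. t0 + (real i)^2 * h)
                                           (\<lambda>i. u (t0 + (real i)^2 * h)))) t0
             = 1 / h * (\<Sum>i=0..k. beta k i * u (t0 + (real i)^2 * h)))
       \<and> (\<lambda>h. deriv u t0 - 1 / h * (\<Sum>i=0..k. beta k i * u (t0 + (real i)^2 * h)))
           \<in> O[at_right 0](\<lambda>h. h ^ k)"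
proof (intro conjI allI impI)
  fix h :: real assume h: "h > 0"
  define L where "L = lagrange_poly k (\<lambda>i. t0 + (real i)^2 * h) (\<lambda>i. u (t0 + (real i)^2 * h))"
  have inj: "inj_on (\<lambda>i. t0 + (real i)^2 * h) {..k}"
    using h by (auto simp: inj_on_def)
  have "deriv (poly L) t0 = poly (pderiv L) t0"
    by (rule DERIV_imp_deriv) (rule poly_DERIV)
  also have "\<dots> = 1 / h * (\<Sum>i=0..k. beta k i * poly L (t0 + (real i)^2 * h))"
    using h lagrange_poly(1)[OF inj] by (intro square_nodes_formula_exact) (auto simp: L_def)
  also have "(\<Sum>i=0..k. beta k i * poly L (t0 + (real i)^2 * h))
      = (\<Sum>i=0..k. beta k i * u (t0 + (real i)^2 * h))"
    by (rule sum.cong) (auto simp: L_def lagrange_poly(2)[OF inj])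
  finally show "deriv (poly L) t0 = 1 / h * (\<Sum>i=0..k. beta k i * u (t0 + (real i)^2 * h))" .
next
  obtain P C d where P: "degree P \<le> k" "poly (pderiv P) t0 = deriv u t0" and "d > 0"
    and R: "\<And>s. 0 \<le> s \<Longrightarrow> s < d \<Longrightarrow> \<bar>u (t0 + s) - poly P (t0 + s)\<bar> \<le> C * s^(k+1)"
    using right_taylor_approximation[OF assms] by metis
  define M where "M = (\<Sum>i=0..k. \<bar>beta k i\<bar> * (C * ((real i)^2)^(k+1)))"
  have bound: "\<bar>deriv u t0 - 1 / h * (\<Sum>i=0..k. beta k i * u (t0 + (real i)^2 * h))\<bar> \<le> M * h^k"
    if h: "0 < h" "h < d / (real k)^2" for h
  proof -
    define r where "r = (\<lambda>i. poly P (t0 + (real i)^2 * h) - u (t0 + (real i)^2 * h))"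
    have r: "\<bar>r i\<bar> \<le> C * ((real i)^2)^(k+1) * h^(k+1)" if "i \<in> {0..k}" for i
    proof -
      have "(real i)^2 * h \<le> (real k)^2 * h"
        using that h by (intro mult_right_mono power_mono) auto
      also have "\<dots> < d"
        using h \<open>k \<ge> 1\<close> by (simp add: field_simps)
      finally have "\<bar>r i\<bar> \<le> C * ((real i)^2 * h)^(k+1)"
        using R[of "(real i)^2 * h"] h by (simp add: r_def abs_minus_commute)
      then show ?thesis by (simp only: power_mult_distrib mult.assoc)
    qed
    have "deriv u t0 - 1 / h * (\<Sum>i=0..k. beta k i * u (t0 + (real i)^2 * h))
        = 1 / h * (\<Sum>i=0..k. beta k i * r i)"
      using square_nodes_formula_exact[OF P(1), of h t0] P(2) h
      by (simp add: r_def right_diff_distrib sum_subtractf diff_divide_distrib)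
    also have "\<bar>\<dots>\<bar> = 1 / h * \<bar>\<Sum>i=0..k. beta k i * r i\<bar>"
      using h by (simp add: abs_mult)
    also have "\<dots> \<le> 1 / h * (\<Sum>i=0..k. \<bar>beta k i * r i\<bar>)"
      using h by (intro mult_left_mono sum_abs) auto
    also have "\<dots> \<le> 1 / h * (\<Sum>i=0..k. \<bar>beta k i\<bar> * (C * ((real i)^2)^(k+1) * h^(k+1)))"
      unfolding abs_mult using h r by (intro mult_left_mono sum_mono) auto
    also have "\<dots> = 1 / h * (M * h^(k+1))"
      by (simp only: M_def sum_distrib_right mult.assoc)
    also have "\<dots> = M * h^k" using h by simp
    finally show ?thesis .
  qed
  have "d / (real k)^2 > 0" using \<open>d > 0\<close> \<open>k \<ge> 1\<close> by simp
  then have "eventually (\<lambda>h. 0 < h \<and> h < d / (real k)^2) (at_right 0)"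
    unfolding eventually_at_right_field by blast
  then show "(\<lambda>h. deriv u t0 - 1 / h * (\<Sum>i=0..k. beta k i * u (t0 + (real i)^2 * h)))
           \<in> O[at_right 0](\<lambda>h. h ^ k)"
  proof (intro bigoI[where c = M], elim eventually_mono conjE)
    fix h :: real assume "0 < h" "h < d / (real k)^2"
    with bound[of h] show "norm (deriv u t0 - 1 / h * (\<Sum>i=0..k. beta k i * u (t0 + (real i)^2 * h)))
        \<le> M * norm (h^k)"
      by (simp add: power_abs)
  qed
qed

end
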